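(* Let $t>0$, let $i_1<\dots<i_M$ be real, let $\underline b=(b_2,\dots,b_{M-1})$ satisfy $-\frac{1}{i_{j+1}-i_j}<b_j<\frac{1}{i_j-i_{j-1}}$ for $j=2,\dots,M-1$, let $\underline k\in\mathbb R_+^{M-2}$ and $\underline\lambda=(\lambda_2,\dots,\lambda_{M-1})\in\mathbb R_+^{M-2}$. For every integer $p\ge1$, the matrix $\widetilde{\mathcal N}_t^{-p}$ has the representation $$(\widetilde{\mathcal N}_t^{-p})_{jk}=\mathbb P(Z_T=k\mid Z_0=j),\qquad j,k\in\{1,\dots,M+1\},$$ where $Z$ is a continuous time Markov chain on $\{1,\dots,M+1\}$ with intensity matrix $\Theta(\underline k,\underline\lambda)$ and $T$, independent of $Z$, has the $\mathrm{Gamma}(p,\frac1t)$ distribution (the law of the sum of $p$ independent exponential variables, each with intensity parameter $1/t$).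
   Context: Conventions: $\mathbb R_+=[0,\infty)$, $M\ge3$. Set $\widetilde k_j=(i_{j+1}-i_j)(i_j-i_{j-1})k_j$ for $2\le j\le M-1$, $\widetilde k_1=\widetilde k_M=0$; for $2\le j\le M-1$, $q_{j,j+1}=\frac{i_j-i_{j-1}}{i_{j+1}-i_{j-1}}(1+(i_{j+1}-i_j)b_j)$, $q_{j,j-1}=\frac{i_{j+1}-i_j}{i_{j+1}-i_{j-1}}(1-(i_j-i_{j-1})b_j)$. $\Theta=\Theta(\underline k,\underline\lambda)$ is the $(M+1)\times(M+1)$ matrix whose rows $1$, $M$, $M+1$ are zero and, for $2\le j\le M-1$, $\Theta_{j,j+1}=\lambda_jq_{j,j+1}$, $\Theta_{j,j-1}=\lambda_jq_{j,j-1}$ (neighbours in $\{1,\dots,M\}$), $\Theta_{jj}=-\lambda_j(1+\widetilde k_j)$, $\Theta_{j,M+1}=\lambda_j\widetilde k_j$, all other entries $0$. $\widetilde{\mathcal N}_t=\widetilde{\mathcal N}_t(\underline k,\underline\lambda)$ is the $(M+1)\times(M+1)$ matrix whose rows $1$, $M$, $M+1$ are those of the identity matrix and, for $2\le j\le M-1$, $\widetilde{\mathcal N}_{t;j,j}=1+t\lambda_j(1+\widetilde k_j)$, $\widetilde{\mathcal N}_{t;j,j+1}=-t\lambda_jq_{j,j+1}$, $\widetilde{\mathcal N}_{t;j,j-1}=-t\lambda_jq_{j,j-1}$, $\widetilde{\mathcal N}_{t;j,M+1}=-t\lambda_j\widetilde k_j$, all other entries $0$. *)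

theory Defs
  imports "HOL-Probability.Probability" "Jordan_Normal_Form.Gauss_Jordan_Elimination"
begin

text \<open>Matrices are given by their entries, with rows and columns numbered from 1. Since the matrices
  of \<open>Jordan_Normal_Form\<close> are numbered from 0, entry \<open>(j, l)\<close> is stored at position
  \<open>(j - 1, l - 1)\<close>.\<close>

definition mat_of_entries :: "nat \<Rightarrow> (nat \<Rightarrow> nat \<Rightarrow> real) \<Rightarrow> real mat" where
  "mat_of_entries n a = Matrix.mat n n (\<lambda>(r, c). a (r + 1) (c + 1))"

definition k_tilde :: "nat \<Rightarrow> (nat \<Rightarrow> real) \<Rightarrow> (nat \<Rightarrow> real) \<Rightarrow> nat \<Rightarrow> real" where
  "k_tilde M i k j =
    (if 2 \<le> j \<and> j \<le> M - 1 then (i (j + 1) - i j) * (i j - i (j - 1)) * k j else 0)"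

definition q_up :: "(nat \<Rightarrow> real) \<Rightarrow> (nat \<Rightarrow> real) \<Rightarrow> nat \<Rightarrow> real" where
  "q_up i b j = (i j - i (j - 1)) / (i (j + 1) - i (j - 1)) * (1 + (i (j + 1) - i j) * b j)"

definition q_down :: "(nat \<Rightarrow> real) \<Rightarrow> (nat \<Rightarrow> real) \<Rightarrow> nat \<Rightarrow> real" where
  "q_down i b j = (i (j + 1) - i j) / (i (j + 1) - i (j - 1)) * (1 - (i j - i (j - 1)) * b j)"

definition Theta ::
  "nat \<Rightarrow> (nat \<Rightarrow> real) \<Rightarrow> (nat \<Rightarrow> real) \<Rightarrow> (nat \<Rightarrow> real) \<Rightarrow> (nat \<Rightarrow> real) \<Rightarrow> nat \<Rightarrow> nat \<Rightarrow> real" where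
  "Theta M i b k lam j l =
    (if 2 \<le> j \<and> j \<le> M - 1 then
       (if l = j + 1 then lam j * q_up i b j
        else if l = j - 1 then lam j * q_down i b j
        else if l = j then - lam j * (1 + k_tilde M i k j)
        else if l = M + 1 then lam j * k_tilde M i k j
        else 0)
     else 0)"

definition N_tilde ::
  "nat \<Rightarrow> (nat \<Rightarrow> real) \<Rightarrow> (nat \<Rightarrow> real) \<Rightarrow> (nat \<Rightarrow> real) \<Rightarrow> (nat \<Rightarrow> real) \<Rightarrow> real \<Rightarrow> nat \<Rightarrow> nat \<Rightarrow> real" where
  "N_tilde M i b k lam t j l =
    (if 2 \<le> j \<and> j \<le> M - 1 then
       (if l = j then 1 + t * lam j * (1 + k_tilde M i k j)
        else if l = j + 1 then - t * lam j * q_up i b j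
        else if l = j - 1 then - t * lam j * q_down i b j
        else if l = M + 1 then - t * lam j * k_tilde M i k j
        else 0)
     else if l = j then 1 else 0)"

definition N_tilde_mat ::
  "nat \<Rightarrow> (nat \<Rightarrow> real) \<Rightarrow> (nat \<Rightarrow> real) \<Rightarrow> (nat \<Rightarrow> real) \<Rightarrow> (nat \<Rightarrow> real) \<Rightarrow> real \<Rightarrow> real mat" where
  "N_tilde_mat M i b k lam t = mat_of_entries (M + 1) (N_tilde M i b k lam t)"

text \<open>Only meaningful for invertible matrices.\<close>

definition mat_neg_power :: "real mat \<Rightarrow> nat \<Rightarrow> real mat" where
  "mat_neg_power A p = the (mat_inverse A) ^\<^sub>m p"

definition transition_function :: "'s set \<Rightarrow> (real \<Rightarrow> 's \<Rightarrow> 's \<Rightarrow> real) \<Rightarrow> bool" where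
  "transition_function S P \<longleftrightarrow>
    (\<forall>t\<ge>0. \<forall>x\<in>S. (\<forall>y\<in>S. 0 \<le> P t x y) \<and> (\<Sum>y\<in>S. P t x y) = 1) \<and>
    (\<forall>x\<in>S. \<forall>y\<in>S. P 0 x y = (if x = y then 1 else 0)) \<and>
    (\<forall>s\<ge>0. \<forall>t\<ge>0. \<forall>x\<in>S. \<forall>z\<in>S. P (s + t) x z = (\<Sum>y\<in>S. P s x y * P t y z))"

definition has_intensity_matrix ::
  "'s set \<Rightarrow> (real \<Rightarrow> 's \<Rightarrow> 's \<Rightarrow> real) \<Rightarrow> ('s \<Rightarrow> 's \<Rightarrow> real) \<Rightarrow> bool" where
  "has_intensity_matrix S P Q \<longleftrightarrow>
    (\<forall>x\<in>S. \<forall>y\<in>S. ((\<lambda>h. P h x y) has_real_derivative Q x y) (at 0 within {0..}))"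

definition markov_with_transitions ::
  "'a measure \<Rightarrow> 's set \<Rightarrow> (real \<Rightarrow> 's \<Rightarrow> 's \<Rightarrow> real) \<Rightarrow> (real \<Rightarrow> 'a \<Rightarrow> 's) \<Rightarrow> bool" where
  "markov_with_transitions \<Omega> S P Z \<longleftrightarrow>
    (\<forall>n (\<tau> :: nat \<Rightarrow> real) (x :: nat \<Rightarrow> 's) u y.
      0 \<le> \<tau> 0 \<and> (\<forall>m<n. \<tau> m < \<tau> (Suc m)) \<and> \<tau> n \<le> u \<and> (\<forall>m\<le>n. x m \<in> S) \<and> y \<in> S \<and>
      \<P>(\<omega> in \<Omega>. \<forall>m\<le>n. Z (\<tau> m) \<omega> = x m) > 0 \<longrightarrow>
      \<P>(\<omega> in \<Omega>. Z u \<omega> = y \<bar> \<forall>m\<le>n. Z (\<tau> m) \<omega> = x m) = P (u - \<tau> n) (x n) y)"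

text \<open>A chain on a finite discrete state space, time-homogeneous, of arbitrary initial law, with
  right-continuous paths; in a discrete space the latter means being constant on some
  interval to the right of each time.\<close>

definition ctmc ::
  "'a measure \<Rightarrow> 's set \<Rightarrow> ('s \<Rightarrow> 's \<Rightarrow> real) \<Rightarrow> (real \<Rightarrow> 'a \<Rightarrow> 's) \<Rightarrow> bool" where
  "ctmc \<Omega> S Q Z \<longleftrightarrow>
    prob_space \<Omega> \<and> finite S \<and>
    (\<forall>t\<ge>0. Z t \<in> measurable \<Omega> (count_space S)) \<and>
    (\<forall>\<omega>\<in>space \<Omega>. \<forall>t\<ge>0. eventually (\<lambda>s. Z s \<omega> = Z t \<omega>) (at_right t)) \<and>
    (\<exists>P. transition_function S P \<and> has_intensity_matrix S P Q \<and> markov_with_transitions \<Omega> S P Z)"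

text \<open>Independence of the generated sigma-algebras; the library's independence of two random variables
  needs a common value type. Nonnegativity of \<open>T\<close> is required everywhere, not only almost surely, so that \<open>Z (T \<omega>) \<omega>\<close>
  only involves \<open>Z\<close> at nonnegative times.\<close>

definition indep_random_time ::
  "'a measure \<Rightarrow> 's set \<Rightarrow> (real \<Rightarrow> 'a \<Rightarrow> 's) \<Rightarrow> ('a \<Rightarrow> real) \<Rightarrow> bool" where
  "indep_random_time \<Omega> S Z T \<longleftrightarrow>
    (\<forall>\<omega>\<in>space \<Omega>. 0 \<le> T \<omega>) \<and>
    prob_space.indep_set \<Omega>
      (sets (vimage_algebra (space \<Omega>) (\<lambda>\<omega>. \<lambda>t\<in>{0..}. Z t \<omega>) (PiM {0..} (\<lambda>_. count_space S))))
      (sets (vimage_algebra (space \<Omega>) T borel))"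

text \<open>For integer shape \<open>p \<ge> 1\<close> and rate \<open>r\<close>, Gamma is the Erlang law; the library's Erlang density
  has first parameter \<open>p - 1\<close>.\<close>

definition gamma_distributed :: "'a measure \<Rightarrow> ('a \<Rightarrow> real) \<Rightarrow> nat \<Rightarrow> real \<Rightarrow> bool" where
  "gamma_distributed \<Omega> T p r \<longleftrightarrow> distributed \<Omega> lborel T (\<lambda>x. ennreal (erlang_density (p - 1) r x))"

end

theory Submission
  imports Defs "Jordan_Normal_Form.Determinant"
begin

text \<open>The matrix \<open>N_tilde\<close> is \<open>I - t \<Theta>\<close>, and \<open>\<Theta>\<close> has nonnegative off-diagonal entries and vanishing row sums,
  so the maximum principle makes \<open>N_tilde\<close> invertible. Let \<open>G\<^sub>p\<close> be the average of the transition
  matrix \<open>P s\<close> against the Gamma density \<open>g\<^sub>p\<close> of shape \<open>p\<close> and rate \<open>1/t\<close>. As \<open>t g\<^sub>p' = g\<^sub>p\<^sub>-\<^sub>1 - g\<^sub>p\<close>,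
  integrating by parts in the backward equation \<open>P' = \<Theta> P\<close> gives \<open>(I - t \<Theta>) G\<^sub>p = G\<^sub>p\<^sub>-\<^sub>1\<close> with \<open>G\<^sub>0 = I\<close>,
  hence \<open>G\<^sub>p\<close> is the \<open>p\<close>-th power of the inverse. The law of the chain at the random time \<open>T\<close> is
  \<open>G\<^sub>p\<close>: for times with countably many values this is immediate from independence, and \<open>T\<close> is
  approximated by such times from the right, where the paths are continuous.\<close>

section \<open>Integration over the half-line and Erlang densities\<close>

text \<open>The fundamental theorem of calculus on the open half-line. The boundary value at 0
  enters as a right-hand limit because the exponential density jumps there; the point 0 itself is a
  null set.\<close>

lemma integral_deriv_halfline:
  fixes f F :: "real \<Rightarrow> real"
  assumes F: "\<And>x. x > 0 \<Longrightarrow> (F has_real_derivative f x) (at x)"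
    and f: "\<And>x. x > 0 \<Longrightarrow> isCont f x"
    and int: "integrable lborel f"
    and neg: "\<And>x. x < 0 \<Longrightarrow> f x = 0"
    and A: "(F \<longlongrightarrow> A) (at_right 0)"
    and B: "(F \<longlongrightarrow> B) at_top"
  shows "integral\<^sup>L lborel f = B - A"
proof -
  have "set_integrable lborel (einterval (ereal 0) \<infinity>) f"
    unfolding set_integrable_def by (rule integrable_mult_indicator) (simp_all add: int)
  then have "(LBINT x=ereal 0..\<infinity>. f x) = B - A"
    by (intro interval_integral_FTC_integrable[where F = F])
      (use A B in \<open>simp_all add: F f ereal_tendsto_simps has_real_derivative_iff_has_vector_derivative[symmetric]\<close>)
  moreover have "(LBINT x=ereal 0..\<infinity>. f x) = (LBINT x:{0<..}. f x)"
    by (simp add: interval_lebesgue_integral_def einterval_def greaterThan_def)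
  moreover have "(LBINT x:{0<..}. f x) = integral\<^sup>L lborel f"
    unfolding set_lebesgue_integral_def
  proof (rule integral_cong_AE)
    show "AE x in lborel. indicat_real {0<..} x *\<^sub>R f x = f x"
      using AE_lborel_singleton[of "0::real"] by eventually_elim (auto simp: indicator_def not_less neg)
  qed (use int in auto)
  ultimately show ?thesis by simp
qed

lemma integrable_erlang_density:
  assumes "0 < r" shows "integrable lborel (erlang_density k r)"
proof (rule integrableI_nonneg)
  show "(\<integral>\<^sup>+ x. ennreal (erlang_density k r x) \<partial>lborel) < \<infinity>"
    using nn_integral_erlang_ith_moment[OF assms, where k = k and i = 0] by simp
qed (use assms in auto)

text \<open>Differentiating the power yields the Erlang density of the previous shape,
  differentiating the exponential yields \<open>- r\<close> times the density itself. For
  \<open>k = 0\<close> the power is constant and the first contribution vanishes.\<close>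

lemma erlang_density_has_derivative:
  assumes "0 < s"
  shows "(erlang_density k r has_real_derivative
    r * ((if k = 0 then 0 else erlang_density (k - 1) r s) - erlang_density k r s)) (at s)"
proof -
  have "((\<lambda>s. r ^ Suc k * s ^ k * exp (- r * s) / fact k) has_real_derivative
      r * ((if k = 0 then 0 else erlang_density (k - 1) r s) - erlang_density k r s)) (at s)"
  proof (cases k)
    case 0
    then show ?thesis
      using assms by (auto simp: erlang_density_def intro!: derivative_eq_intros)
  next
    case (Suc m)
    have "((\<lambda>s. r ^ Suc k * s ^ k * exp (- r * s) / fact k) has_real_derivative
        (r ^ Suc k * (real k * s ^ m) * exp (- r * s) + r ^ Suc k * s ^ k * (exp (- r * s) * - r)) / fact k) (at s)"
      by (rule DERIV_cdivide, (rule derivative_eq_intros refl)+) (simp add: Suc algebra_simps)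
    moreover have "(r ^ Suc k * (real k * s ^ m) * exp (- r * s) + r ^ Suc k * s ^ k * (exp (- r * s) * - r)) / fact k
        = r * (r ^ Suc m * s ^ m * exp (- r * s) / fact m - r ^ Suc k * s ^ k * exp (- r * s) / fact k)"
      by (simp add: Suc field_simps del: of_nat_Suc)
    ultimately show ?thesis
      using assms by (simp add: erlang_density_def Suc)
  qed
  \<comment> \<open>The closed formula and the density agree on the open half-line, a neighbourhood
    of \<open>s\<close>, so the derivative carries over.\<close>
  moreover have "\<forall>\<^sub>F s in nhds s. r ^ Suc k * s ^ k * exp (- r * s) / fact k = erlang_density k r s"
    by (rule eventually_mono[OF eventually_nhds_in_open[of "{0<..}"]])
      (use assms in \<open>simp_all add: erlang_density_def\<close>)
  ultimately show ?thesis
    by (simp only: DERIV_cong_ev[OF refl _ refl])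
qed

text \<open>Only the exponential density has a nonzero limit at 0; this is the boundary term that
  starts the recursion over the shape.\<close>

lemma tendsto_erlang_density_at_right_0:
  "(erlang_density k r \<longlongrightarrow> (if k = 0 then r else 0)) (at_right 0)"
proof -
  have "((\<lambda>s. r ^ Suc k * s ^ k * exp (- r * s) / fact k) \<longlongrightarrow> r ^ Suc k * 0 ^ k * exp (- r * 0) / fact k)
      (at_right 0)"
    by (intro tendsto_intros) auto
  moreover have "\<forall>\<^sub>F s in at_right 0. r ^ Suc k * s ^ k * exp (- r * s) / fact k = erlang_density k r s"
    using eventually_at_right_less by eventually_elim (simp add: erlang_density_def)
  ultimately have "(erlang_density k r \<longlongrightarrow> r ^ Suc k * 0 ^ k * exp (- r * 0) / fact k) (at_right 0)"
    using Lim_transform_eventually by blast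
  then show ?thesis by (auto split: if_splits simp: power_0_left)
qed

lemma tendsto_erlang_density_at_top:
  assumes "0 < r" shows "(erlang_density k r \<longlongrightarrow> 0) at_top"
proof -
  have "filterlim (\<lambda>s. r * s) at_top at_top"
    using assms by (intro filterlim_tendsto_pos_mult_at_top[OF tendsto_const] filterlim_ident) auto
  from filterlim_compose[OF tendsto_power_div_exp_0[of k] this]
  have "((\<lambda>s. r / fact k * ((r * s) ^ k / exp (r * s))) \<longlongrightarrow> r / fact k * 0) at_top"
    by (intro tendsto_mult tendsto_const)
  moreover have "\<forall>\<^sub>F s in at_top. r / fact k * ((r * s) ^ k / exp (r * s)) = erlang_density k r s"
    using eventually_gt_at_top[of 0]
    by eventually_elim (simp add: erlang_density_def exp_minus field_simps)
  ultimately show ?thesis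
    using Lim_transform_eventually by fastforce
qed

section \<open>Transition semigroups on a finite set and their Gamma averages\<close>

locale finite_transition_semigroup =
  fixes S :: "'s set" and P :: "real \<Rightarrow> 's \<Rightarrow> 's \<Rightarrow> real" and Q :: "'s \<Rightarrow> 's \<Rightarrow> real"
  assumes finite_S: "finite S"
    and transition_function: "transition_function S P"
    and intensity_matrix: "has_intensity_matrix S P Q"
begin

lemma P_nonneg: "0 \<le> s \<Longrightarrow> x \<in> S \<Longrightarrow> y \<in> S \<Longrightarrow> 0 \<le> P s x y"
  and P_row_sum: "0 \<le> s \<Longrightarrow> x \<in> S \<Longrightarrow> (\<Sum>y\<in>S. P s x y) = 1"
  and P_zero: "x \<in> S \<Longrightarrow> y \<in> S \<Longrightarrow> P 0 x y = (if x = y then 1 else 0)"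
  and P_add: "0 \<le> h \<Longrightarrow> 0 \<le> s \<Longrightarrow> x \<in> S \<Longrightarrow> z \<in> S \<Longrightarrow> P (h + s) x z = (\<Sum>y\<in>S. P h x y * P s y z)"
  using transition_function unfolding transition_function_def by blast+

lemma P_le_one:
  assumes "0 \<le> s" "x \<in> S" "y \<in> S" shows "P s x y \<le> 1"
  using member_le_sum[of y S "P s x"] finite_S P_nonneg P_row_sum assms by force

lemma P_abs_le_one:
  assumes "0 \<le> s" "x \<in> S" "y \<in> S" shows "\<bar>P s x y\<bar> \<le> 1"
  using P_le_one P_nonneg assms by simp

text \<open>Chapman-Kolmogorov for \<open>h + s\<close> minus that for \<open>0 + s\<close>. With
  the short time in the first factor, all regularity in time reduces to the behaviour of
  \<open>P\<close> at 0.\<close>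

lemma P_increment:
  assumes "0 \<le> h" "0 \<le> s" "x \<in> S" "z \<in> S"
  shows "P (h + s) x z - P s x z = (\<Sum>y\<in>S. (P h x y - P 0 x y) * P s y z)"
  using P_add[of h s x z] P_add[of 0 s x z] assms by (simp add: left_diff_distrib sum_subtractf)

lemma P_deriv_0:
  "x \<in> S \<Longrightarrow> y \<in> S \<Longrightarrow> ((\<lambda>h. P h x y) has_real_derivative Q x y) (at 0 within {0..})"
  using intensity_matrix unfolding has_intensity_matrix_def by blast

lemma P_tendsto_0:
  assumes "x \<in> S" "y \<in> S" shows "((\<lambda>h. P h x y) \<longlongrightarrow> P 0 x y) (at_right 0)"
  using DERIV_continuous[OF P_deriv_0[OF assms]]
  by (simp add: continuous_within at_within_Ici_at_right)

lemma P_quotient_tendsto_0: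
  assumes "x \<in> S" "y \<in> S" shows "((\<lambda>h. (P h x y - P 0 x y) / h) \<longlongrightarrow> Q x y) (at_right 0)"
  using P_deriv_0[OF assms] by (simp add: has_field_derivative_iff at_within_Ici_at_right)

text \<open>Apply the increment identity at base time \<open>s - h\<close>: the factors
  \<open>P (s - h) y z\<close> are bounded by 1, so the difference is controlled by
  \<open>P h - P 0\<close> alone.\<close>

lemma P_left_tendsto:
  assumes "0 < s" "x \<in> S" "z \<in> S" shows "((\<lambda>h. P (s - h) x z) \<longlongrightarrow> P s x z) (at_right 0)"
proof (rule LIM_zero_cancel, rule Lim_null_comparison)
  show "((\<lambda>h. \<Sum>y\<in>S. \<bar>P h x y - P 0 x y\<bar>) \<longlongrightarrow> 0) (at_right 0)"
    by (intro tendsto_null_sum tendsto_rabs_zero LIM_zero P_tendsto_0 assms)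
  have "\<forall>\<^sub>F h in at_right 0. h \<in> {0<..<s}"
    by (rule eventually_at_rightI[of 0 s]) (use assms in auto)
  then show "\<forall>\<^sub>F h in at_right 0. norm (P (s - h) x z - P s x z) \<le> (\<Sum>y\<in>S. \<bar>P h x y - P 0 x y\<bar>)"
  proof eventually_elim
    case (elim h)
    have "norm (P (s - h) x z - P s x z) = \<bar>\<Sum>y\<in>S. (P h x y - P 0 x y) * P (s - h) y z\<bar>"
      using P_increment[of h "s - h" x z] elim assms by simp
    also have "\<dots> \<le> (\<Sum>y\<in>S. \<bar>(P h x y - P 0 x y) * P (s - h) y z\<bar>)"
      by (rule sum_abs)
    also have "\<dots> \<le> (\<Sum>y\<in>S. \<bar>P h x y - P 0 x y\<bar>)"
      by (intro sum_mono) (use P_abs_le_one elim assms in \<open>auto simp: abs_mult intro!: mult_left_le\<close>)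
    finally show ?case .
  qed
qed

lemma backward_equation:
  assumes "0 < s" "x \<in> S" "z \<in> S"
  shows "((\<lambda>s. P s x z) has_real_derivative (\<Sum>y\<in>S. Q x y * P s y z)) (at s)"
proof -
  \<comment> \<open>On the right, the second factor \<open>P s y z\<close> of the increment stays
    fixed and the quotient converges by the derivative at 0.\<close>
  have "((\<lambda>h. (P (s + h) x z - P s x z) / h) \<longlongrightarrow> (\<Sum>y\<in>S. Q x y * P s y z)) (at_right 0)"
  proof (rule Lim_transform_eventually)
    show "((\<lambda>h. \<Sum>y\<in>S. (P h x y - P 0 x y) / h * P s y z) \<longlongrightarrow> (\<Sum>y\<in>S. Q x y * P s y z)) (at_right 0)"
      by (intro tendsto_sum tendsto_mult P_quotient_tendsto_0 tendsto_const assms)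
    show "\<forall>\<^sub>F h in at_right 0. (\<Sum>y\<in>S. (P h x y - P 0 x y) / h * P s y z) = (P (s + h) x z - P s x z) / h"
      using eventually_at_right_less
      by eventually_elim (use P_increment[of _ s x z] assms in \<open>simp add: sum_divide_distrib add.commute\<close>)
  qed
  moreover have "((\<lambda>h. (P (s + h) x z - P s x z) / h) \<longlongrightarrow> (\<Sum>y\<in>S. Q x y * P s y z)) (at_left 0)"
  proof -
    \<comment> \<open>The left-hand limit is rewritten with positive \<open>h\<close>. Now the
      second factor moves with \<open>h\<close>, which is where left continuity enters.\<close>
    have "((\<lambda>h. (P (s - h) x z - P s x z) / - h) \<longlongrightarrow> (\<Sum>y\<in>S. Q x y * P s y z)) (at_right 0)"
    proof (rule Lim_transform_eventually)
      show "((\<lambda>h. \<Sum>y\<in>S. (P h x y - P 0 x y) / h * P (s - h) y z) \<longlongrightarrow> (\<Sum>y\<in>S. Q x y * P s y z)) (at_right 0)"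
        by (intro tendsto_sum tendsto_mult P_quotient_tendsto_0 P_left_tendsto assms)
      have "\<forall>\<^sub>F h in at_right 0. h \<in> {0<..<s}"
        by (rule eventually_at_rightI[of 0 s]) (use assms in auto)
      then show "\<forall>\<^sub>F h in at_right 0. (\<Sum>y\<in>S. (P h x y - P 0 x y) / h * P (s - h) y z) =
          (P (s - h) x z - P s x z) / - h"
      proof eventually_elim
        case (elim h)
        then have "(\<Sum>y\<in>S. (P h x y - P 0 x y) / h * P (s - h) y z) = (P s x z - P (s - h) x z) / h"
          using P_increment[of h "s - h" x z] assms by (simp add: sum_divide_distrib)
        then show ?case using elim by (simp add: field_simps)
      qed
    qed
    then show ?thesis
      using filterlim_at_left_to_right[of "\<lambda>h. (P (s + h) x z - P s x z) / h" _ 0] by simp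
  qed
  ultimately show ?thesis
    by (simp add: DERIV_def filterlim_split_at_real)
qed

lemma P_continuous_on:
  assumes "x \<in> S" "z \<in> S" shows "continuous_on {0..} (\<lambda>s. P s x z)"
  unfolding continuous_on_eq_continuous_within
proof
  fix s :: real assume "s \<in> {0..}"
  then show "continuous (at s within {0..}) (\<lambda>s. P s x z)"
    using DERIV_continuous[OF P_deriv_0[OF assms]] backward_equation[OF _ assms, of s]
    by (cases "s = 0") (auto intro: continuous_at_imp_continuous_at_within dest: DERIV_isCont)
qed

text \<open>Nothing is known about \<open>P\<close> at negative times, so the indicator extends it
  by 0 to a Borel function on the line.\<close>

lemma P_measurable:
  assumes "x \<in> S" "z \<in> S" shows "(\<lambda>s. indicat_real {0..} s * P s x z) \<in> borel_measurable borel"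
  using borel_measurable_continuous_on_indicator[OF _ P_continuous_on[OF assms]] by simp

lemma integrable_erlang_P:
  assumes "0 < r" "x \<in> S" "z \<in> S"
  shows "integrable lborel (\<lambda>s. erlang_density k r s * P s x z)"
proof (rule Bochner_Integration.integrable_bound)
  show "integrable lborel (erlang_density k r)"
    by (rule integrable_erlang_density) fact
  have "(\<lambda>s. erlang_density k r s * P s x z) = (\<lambda>s. erlang_density k r s * (indicat_real {0..} s * P s x z))"
    by (auto simp: erlang_density_def indicator_def)
  then show "(\<lambda>s. erlang_density k r s * P s x z) \<in> borel_measurable lborel"
    using P_measurable[OF assms(2,3)] by simp
  show "AE s in lborel. norm (erlang_density k r s * P s x z) \<le> norm (erlang_density k r s)"
  proof (rule AE_I2)
    fix s show "norm (erlang_density k r s * P s x z) \<le> norm (erlang_density k r s)"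
    proof (cases "s < 0")
      case False
      then show ?thesis
        using P_abs_le_one[of s x z] assms by (auto simp: abs_mult intro!: mult_left_le)
    qed (simp add: erlang_density_def)
  qed
qed

text \<open>The Gamma shape is \<open>k + 1\<close>, following the parameter of
  \<open>erlang_density\<close>. Up to scaling these are the entries of powers of the resolvent of
  \<open>Q\<close>.\<close>

definition gamma_mean :: "nat \<Rightarrow> real \<Rightarrow> 's \<Rightarrow> 's \<Rightarrow> real" where
  "gamma_mean k r x z = (\<integral>s. erlang_density k r s * P s x z \<partial>lborel)"

text \<open>Integration by parts: the derivative of \<open>erlang_density k r s * P s x z\<close>
  integrates to minus its limit at 0. The density contributes the averages of the previous and the
  same shape, the backward equation contributes the term with \<open>Q\<close>. For
  \<open>k = 0\<close> the boundary term replaces the previous shape.\<close>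

lemma gamma_mean_resolvent:
  assumes "0 < r" "x \<in> S" "z \<in> S"
  shows "r * gamma_mean k r x z - (\<Sum>y\<in>S. Q x y * gamma_mean k r y z) =
    r * (if k = 0 then P 0 x z else gamma_mean (k - 1) r x z)"
proof -
  let ?E = "erlang_density k r" and ?E' = "\<lambda>s. if k = 0 then 0 else erlang_density (k - 1) r s"
  \<comment> \<open>\<open>?f\<close> is the derivative of the product, expanded so that its
    integral splits into Gamma averages, and \<open>?A\<close> is the limit of the product at
    0.\<close>
  let ?f = "\<lambda>s. r * (?E' s * P s x z) - r * (?E s * P s x z) + (\<Sum>y\<in>S. Q x y * (?E s * P s y z))"
  let ?A = "(if k = 0 then r else 0) * P 0 x z"
  have int': "integrable lborel (\<lambda>s. ?E' s * P s x z)"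
    using integrable_erlang_P[OF assms] by (cases "k = 0") auto
  have "integral\<^sup>L lborel ?f = 0 - ?A"
  proof (rule integral_deriv_halfline[where F = "\<lambda>s. ?E s * P s x z"])
    fix s :: real assume s: "s > 0"
    have "((\<lambda>s. ?E s * P s x z) has_real_derivative
        r * (?E' s - ?E s) * P s x z + (\<Sum>y\<in>S. Q x y * P s y z) * ?E s) (at s)"
      by (rule DERIV_mult[OF erlang_density_has_derivative[OF s] backward_equation[OF s assms(2,3)]])
    moreover have "r * (?E' s - ?E s) * P s x z + (\<Sum>y\<in>S. Q x y * P s y z) * ?E s = ?f s"
      by (simp add: sum_distrib_right sum_distrib_left algebra_simps)
    ultimately show "((\<lambda>s. ?E s * P s x z) has_real_derivative ?f s) (at s)"
      by simp
    have E: "isCont (erlang_density m r) s" for m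
      using DERIV_isCont erlang_density_has_derivative s by blast
    have P: "isCont (\<lambda>s. P s y z) s" if "y \<in> S" for y
      using DERIV_isCont backward_equation s assms that by blast
    have "isCont (\<lambda>s. ?E' s) s"
      using E by (cases "k = 0") auto
    then show "isCont ?f s"
      by (intro continuous_intros E P assms)
  next
    show "integrable lborel ?f"
      by (intro Bochner_Integration.integrable_add Bochner_Integration.integrable_diff
          Bochner_Integration.integrable_sum integrable_mult_right int' integrable_erlang_P assms)
    show "((\<lambda>s. ?E s * P s x z) \<longlongrightarrow> ?A) (at_right 0)"
      by (intro tendsto_mult tendsto_erlang_density_at_right_0 P_tendsto_0 assms)
    show "((\<lambda>s. ?E s * P s x z) \<longlongrightarrow> 0) at_top"
    proof (rule Lim_null_comparison)
      show "(?E \<longlongrightarrow> 0) at_top" by (rule tendsto_erlang_density_at_top) fact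
      show "\<forall>\<^sub>F s in at_top. norm (?E s * P s x z) \<le> ?E s"
        using eventually_ge_at_top[of 0]
        by eventually_elim (use P_abs_le_one assms in \<open>auto simp: abs_mult intro!: mult_left_le\<close>)
    qed
  qed (simp add: erlang_density_def)
  moreover have "integral\<^sup>L lborel ?f = r * (if k = 0 then 0 else gamma_mean (k - 1) r x z)
      - r * gamma_mean k r x z + (\<Sum>y\<in>S. Q x y * gamma_mean k r y z)"
    using int' integrable_erlang_P[OF assms(1)] assms
    by (subst Bochner_Integration.integral_add Bochner_Integration.integral_diff
        Bochner_Integration.integral_sum; simp add: gamma_mean_def)+
  ultimately show ?thesis
    by (auto split: if_splits)
qed

end


section \<open>A right-continuous process at an independent random time\<close>

text \<open>In the application \<open>c\<close> is the probability of starting in \<open>j\<close>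
  and \<open>p\<close> the transition probability from \<open>j\<close> to \<open>l\<close>. Joint
  probabilities are used so that independence can be applied to one path event. The time is
  discretized from above, as the paths are continuous only from the right.\<close>

lemma (in prob_space) prob_at_independent_time:
  fixes Z :: "real \<Rightarrow> 'a \<Rightarrow> 's" and T :: "'a \<Rightarrow> real"
  assumes Z [measurable]: "\<And>t. 0 \<le> t \<Longrightarrow> Z t \<in> measurable M (count_space S)"
    and Z_right: "\<And>\<omega> t. \<omega> \<in> space M \<Longrightarrow> 0 \<le> t \<Longrightarrow> \<forall>\<^sub>F s in at_right t. Z s \<omega> = Z t \<omega>"
    and T [measurable]: "T \<in> borel_measurable M"
    and T_indep: "indep_random_time M S Z T"
    and p_cont: "continuous_on {0..} p"
    and p_bound: "\<And>s. 0 \<le> s \<Longrightarrow> \<bar>p s\<bar> \<le> 1"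
    and p: "\<And>s. 0 \<le> s \<Longrightarrow> \<P>(\<omega> in M. Z s \<omega> = l \<and> Z 0 \<omega> = j) = c * p s"
  shows "\<P>(\<omega> in M. Z (T \<omega>) \<omega> = l \<and> Z 0 \<omega> = j) = c * (\<integral>\<omega>. p (T \<omega>) \<partial>M)"
proof -
  have T_nonneg: "0 \<le> T \<omega>" if "\<omega> \<in> space M" for \<omega>
    using T_indep that unfolding indep_random_time_def by blast
  \<comment> \<open>\<open>K m\<close> numbers the grid cell of width \<open>1 / Suc m\<close> that
    contains \<open>T\<close>, and \<open>R m\<close> gives the right endpoint of a cell, which lies
    strictly above \<open>T\<close>.\<close>
  define K where "K m \<omega> = nat \<lfloor>real (Suc m) * T \<omega>\<rfloor>" for m \<omega>
  define R where "R m q = real (Suc q) / real (Suc m)" for m q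
  have K [measurable]: "K m \<in> measurable M (count_space UNIV)" for m
    unfolding K_def by measurable
  have R_nonneg: "0 \<le> R m q" for m q by (simp add: R_def)
  have R_gt: "T \<omega> < R m (K m \<omega>)" and R_le: "R m (K m \<omega>) \<le> T \<omega> + 1 / real (Suc m)" if "\<omega> \<in> space M" for m \<omega>
  proof -
    have "0 \<le> real (Suc m) * T \<omega>" using T_nonneg[OF that] by simp
    then have "real (K m \<omega>) = of_int \<lfloor>real (Suc m) * T \<omega>\<rfloor>" unfolding K_def by simp
    then have "real (Suc m) * T \<omega> < real (Suc (K m \<omega>))" "real (K m \<omega>) \<le> real (Suc m) * T \<omega>"
      by linarith+
    then show "T \<omega> < R m (K m \<omega>)" "R m (K m \<omega>) \<le> T \<omega> + 1 / real (Suc m)"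
      unfolding R_def by (simp_all add: field_simps del: of_nat_Suc)
  qed
  have R_lim: "(\<lambda>m. R m (K m \<omega>)) \<longlonglongrightarrow> T \<omega>" if "\<omega> \<in> space M" for \<omega>
  proof (rule tendsto_sandwich[where f = "\<lambda>_. T \<omega>" and h = "\<lambda>m. T \<omega> + 1 / real (Suc m)"])
    show "(\<lambda>m. T \<omega> + 1 / real (Suc m)) \<longlonglongrightarrow> T \<omega>"
      using tendsto_add[OF tendsto_const LIMSEQ_inverse_real_of_nat, of "T \<omega>"] by (simp add: inverse_eq_divide)
    show "\<forall>\<^sub>F m in sequentially. T \<omega> \<le> R m (K m \<omega>)"
      using R_gt[OF that] by (intro always_eventually allI less_imp_le)
    show "\<forall>\<^sub>F m in sequentially. R m (K m \<omega>) \<le> T \<omega> + 1 / real (Suc m)"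
      using R_le[OF that] by (intro always_eventually allI)
  qed (rule tendsto_const)
  \<comment> \<open>Strictness is essential: it turns convergence to \<open>T\<close> into
    convergence along \<open>at_right\<close>.\<close>
  then have R_lim_right: "filterlim (\<lambda>m. R m (K m \<omega>)) (at_right (T \<omega>)) sequentially" if "\<omega> \<in> space M" for \<omega>
    using R_gt[OF that] by (auto simp: filterlim_at that less_imp_neq[symmetric] intro!: always_eventually)

  \<comment> \<open>The centred indicator has mean 0 at every fixed time; the aim is mean 0 at time
    \<open>T\<close> as well.\<close>
  define C where "C t \<omega> = of_bool (Z t \<omega> = l \<and> Z 0 \<omega> = j) - c * p t" for t \<omega>
  have Z_eq [measurable]: "Measurable.pred M (\<lambda>\<omega>. Z t \<omega> = y)" if "0 \<le> t" for t y
    using measurable_compose[OF Z[OF that], of "\<lambda>z. z = y" "count_space UNIV"] by simp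
  have C_meas: "C t \<in> borel_measurable M" if "0 \<le> t" for t
  proof -
    note [measurable] = Z_eq[OF that] Z_eq[of 0, simplified]
    show ?thesis unfolding C_def by measurable
  qed
  have C_bound: "\<bar>C t \<omega>\<bar> \<le> 1 + \<bar>c\<bar>" if "0 \<le> t" for t \<omega>
  proof -
    have "\<bar>c * p t\<bar> \<le> \<bar>c\<bar>" using p_bound[OF that] by (simp add: abs_mult mult_left_le)
    then show ?thesis unfolding C_def by (auto simp: abs_le_iff)
  qed
  have CK_meas: "(\<lambda>\<omega>. C (R m (K m \<omega>)) \<omega>) \<in> borel_measurable M" for m
    by (rule measurable_compose_countable[OF _ K]) (use C_meas R_nonneg in auto)

  \<comment> \<open>On each level set \<open>A q\<close> the discretized time is the constant
    \<open>R m q\<close>. As \<open>A q\<close> depends only on \<open>T\<close> and the event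
    \<open>?B\<close> only on the path, independence makes the integral over \<open>A q\<close>
    vanish; these countably many integrals add up.\<close>
  have "(\<integral>\<omega>. C (R m (K m \<omega>)) \<omega> \<partial>M) = 0" for m
  proof -
    define A where "A q = {\<omega> \<in> space M. K m \<omega> = q}" for q
    have A [measurable]: "A q \<in> sets M" for q unfolding A_def by measurable
    have "(LINT \<omega>:A q|M. C (R m (K m \<omega>)) \<omega>) = 0" for q
    proof -
      let ?s = "R m q"
      let ?B = "{\<omega> \<in> space M. Z ?s \<omega> = l \<and> Z 0 \<omega> = j}"
      note [measurable] = Z_eq[OF R_nonneg[of m q]] Z_eq[of 0, simplified]
      have B: "?B \<in> sets M" by measurable
      let ?PM = "PiM {0..} (\<lambda>_. count_space S) :: (real \<Rightarrow> 's) measure"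
      \<comment> \<open>The path event involves only the coordinates \<open>?s\<close> and 0, so it
        is measurable in the product space; its preimage is \<open>?B\<close>.\<close>
      have "{z \<in> space ?PM. z ?s = l \<and> z 0 = j} \<in> sets ?PM"
      proof -
        have "Measurable.pred ?PM (\<lambda>z. z t = y)" if "0 \<le> t" for t y
          using measurable_compose[OF measurable_component_singleton[of t "{0..}" "\<lambda>_. count_space S"],
              of "\<lambda>z. z = y" "count_space UNIV"] that by simp
        note [measurable] = this[OF R_nonneg[of m q]] this[of 0, simplified]
        show ?thesis by measurable
      qed
      from in_vimage_algebra[OF this, of "\<lambda>\<omega>. \<lambda>t\<in>{0..}. Z t \<omega>" "space M"]
      have "?B \<in> sets (vimage_algebra (space M) (\<lambda>\<omega>. \<lambda>t\<in>{0..}. Z t \<omega>) ?PM)"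
      proof (rule back_subst[of "\<lambda>X. X \<in> _"])
        show "(\<lambda>\<omega>. \<lambda>t\<in>{0..}. Z t \<omega>) -` {z \<in> space ?PM. z ?s = l \<and> z 0 = j} \<inter> space M = ?B"
          using R_nonneg[of m q] Z[THEN measurable_space] by (auto simp: space_PiM)
      qed
      moreover have "A q \<in> sets (vimage_algebra (space M) T borel)"
      proof -
        have "{s. nat \<lfloor>real (Suc m) * s\<rfloor> = q} \<in> sets borel" by measurable
        from in_vimage_algebra[OF this, of T "space M"] show ?thesis
          unfolding A_def K_def by (rule back_subst[of "\<lambda>X. X \<in> _"]) auto
      qed
      ultimately have "prob (?B \<inter> A q) = prob ?B * prob (A q)"
        using T_indep unfolding indep_random_time_def by (blast intro: indep_setD)
      then have "prob (?B \<inter> A q) = c * p ?s * prob (A q)"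
        using p[OF R_nonneg[of m q]] by simp
      moreover have "(LINT \<omega>:A q|M. C (R m (K m \<omega>)) \<omega>) =
          (\<integral>\<omega>. indicator (?B \<inter> A q) \<omega> - c * p ?s * indicator (A q) \<omega> \<partial>M)"
        unfolding set_lebesgue_integral_def
        by (rule Bochner_Integration.integral_cong) (auto simp: A_def C_def indicator_def)
      moreover have "integrable M (indicat_real X)" if "X \<in> sets M" for X
        by (rule integrable_real_indicator) (auto simp: that less_top[symmetric])
      ultimately show ?thesis
        using B A[of q] by (simp add: Int_absorb2 sets.Int sets.sets_into_space)
    qed
    moreover have "(\<Union>q. A q) = space M" unfolding A_def by auto
    moreover have "integrable M (\<lambda>\<omega>. C (R m (K m \<omega>)) \<omega>)"
      by (rule integrable_const_bound[where B = "1 + \<bar>c\<bar>"]) (use C_bound R_nonneg CK_meas in auto)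
    moreover have "disjoint_family A" unfolding A_def disjoint_family_on_def by auto
    ultimately show ?thesis
      using lebesgue_integral_countable_add[of A M "\<lambda>\<omega>. C (R m (K m \<omega>)) \<omega>"] A
        integrable_mult_indicator[OF sets.top, of M "\<lambda>\<omega>. C (R m (K m \<omega>)) \<omega>"]
      by (simp add: set_integral_space set_integrable_def disjoint_family_on_def)
  qed
  \<comment> \<open>The term with \<open>p\<close> converges by continuity, while the indicator is
    eventually constant because the path does not move just after \<open>T\<close>.\<close>
  moreover have C_lim: "(\<lambda>m. C (R m (K m \<omega>)) \<omega>) \<longlonglongrightarrow> C (T \<omega>) \<omega>" if "\<omega> \<in> space M" for \<omega>
  proof -
    have "(p \<longlongrightarrow> p (T \<omega>)) (at_right (T \<omega>))"
      by (rule tendsto_within_subset[of _ _ _ "{0..}"])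
        (use p_cont T_nonneg[OF that] in \<open>auto simp: continuous_on_def\<close>)
    from filterlim_compose[OF this R_lim_right[OF that]]
    have "(\<lambda>m. of_bool (Z (T \<omega>) \<omega> = l \<and> Z 0 \<omega> = j) - c * p (R m (K m \<omega>))) \<longlonglongrightarrow> C (T \<omega>) \<omega>"
      unfolding C_def by (intro tendsto_intros)
    moreover have "\<forall>\<^sub>F m in sequentially. Z (R m (K m \<omega>)) \<omega> = Z (T \<omega>) \<omega>"
      using eventually_compose_filterlim[OF Z_right[OF that T_nonneg[OF that]] R_lim_right[OF that]] .
    then have "\<forall>\<^sub>F m in sequentially.
        of_bool (Z (T \<omega>) \<omega> = l \<and> Z 0 \<omega> = j) - c * p (R m (K m \<omega>)) = C (R m (K m \<omega>)) \<omega>"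
      by eventually_elim (simp add: C_def)
    ultimately show ?thesis
      by (rule Lim_transform_eventually)
  qed
  \<comment> \<open>Measurability of the process at time \<open>T\<close> comes from the pointwise
    limit of the discretizations.\<close>
  moreover have CT_meas: "(\<lambda>\<omega>. C (T \<omega>) \<omega>) \<in> borel_measurable M"
    by (rule borel_measurable_LIMSEQ_real[OF C_lim CK_meas])
  moreover have "(\<lambda>m. \<integral>\<omega>. C (R m (K m \<omega>)) \<omega> \<partial>M) \<longlonglongrightarrow> (\<integral>\<omega>. C (T \<omega>) \<omega> \<partial>M)"
    by (rule integral_dominated_convergence[where w = "\<lambda>_. 1 + \<bar>c\<bar>"])
      (use C_lim C_bound R_nonneg CK_meas CT_meas in auto)
  ultimately have "(\<integral>\<omega>. C (T \<omega>) \<omega> \<partial>M) = 0"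
    by (simp add: LIMSEQ_const_iff)
  moreover have pT: "integrable M (\<lambda>\<omega>. p (T \<omega>))"
  proof (rule integrable_const_bound[where B = 1])
    have "(\<lambda>\<omega>. indicator {0..} (T \<omega>) *\<^sub>R p (T \<omega>)) \<in> borel_measurable M"
      using measurable_compose[OF T borel_measurable_continuous_on_indicator[OF _ p_cont]] by simp
    then show "(\<lambda>\<omega>. p (T \<omega>)) \<in> borel_measurable M"
      by (rule measurable_cong[THEN iffD1, rotated]) (use T_nonneg in auto)
  qed (use p_bound T_nonneg in auto)
  moreover have CT: "integrable M (\<lambda>\<omega>. C (T \<omega>) \<omega>)"
    by (rule integrable_const_bound[where B = "1 + \<bar>c\<bar>"]) (use C_bound T_nonneg CT_meas in auto)
  moreover have "\<P>(\<omega> in M. Z (T \<omega>) \<omega> = l \<and> Z 0 \<omega> = j) = (\<integral>\<omega>. C (T \<omega>) \<omega> + c * p (T \<omega>) \<partial>M)"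
  proof -
    let ?D = "{\<omega> \<in> space M. Z (T \<omega>) \<omega> = l \<and> Z 0 \<omega> = j}"
    have "prob ?D = (\<integral>\<omega>. indicator ?D \<omega> \<partial>M)"
      by (simp add: Int_absorb2)
    also have "\<dots> = (\<integral>\<omega>. C (T \<omega>) \<omega> + c * p (T \<omega>) \<partial>M)"
      by (rule Bochner_Integration.integral_cong) (auto simp: C_def indicator_def)
    finally show ?thesis .
  qed
  ultimately show ?thesis by simp
qed

section \<open>Invertibility and inverse powers of matrices\<close>

text \<open>Maximum principle: where a kernel vector has maximal modulus, the sign conditions and
  zero row sums of \<open>Q\<close> force this modulus to be at most 0, so the kernel is
  trivial.\<close>

lemma invertible_mat_minus_generator:
  fixes Q :: "nat \<Rightarrow> nat \<Rightarrow> real"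
  assumes t: "0 \<le> t"
    and Q_nonneg: "\<And>x y. x \<in> {1..n} \<Longrightarrow> y \<in> {1..n} \<Longrightarrow> x \<noteq> y \<Longrightarrow> 0 \<le> Q x y"
    and Q_sum: "\<And>x. x \<in> {1..n} \<Longrightarrow> (\<Sum>y\<in>{1..n}. Q x y) = 0"
  shows "invertible_mat (mat_of_entries n (\<lambda>x y. (if x = y then 1 else 0) - t * Q x y))"
proof -
  let ?A = "mat_of_entries n (\<lambda>x y. (if x = y then 1 else 0) - t * Q x y)"
  have A: "?A \<in> carrier_mat n n" by (simp add: mat_of_entries_def)
  have "det ?A \<noteq> 0"
  proof
    assume "det ?A = 0"
    then obtain v where v: "v \<in> carrier_vec n" "v \<noteq> 0\<^sub>v n" "?A *\<^sub>v v = 0\<^sub>v n"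
      using det_0_iff_vec_prod_zero_field[OF A] by blast
    define w where "w x = vec_index v (x - 1)" for x
    have "n \<noteq> 0" using v(1,2) by (intro notI) auto
    have eq: "w x = t * (\<Sum>y\<in>{1..n}. Q x y * w y)" if x: "x \<in> {1..n}" for x
    proof -
      have "0 = vec_index (?A *\<^sub>v v) (x - 1)" using v x by auto
      also have "\<dots> = (\<Sum>c\<in>{0..<n}. ((if x = c + 1 then 1 else 0) - t * Q x (c + 1)) * vec_index v c)"
        using v(1) x by (auto simp: mat_of_entries_def scalar_prod_def intro!: sum.cong)
      also have "\<dots> = (\<Sum>y\<in>{1..n}. ((if x = y then 1 else 0) - t * Q x y) * w y)"
        by (rule sum.reindex_bij_witness[where i = "\<lambda>y. y - 1" and j = "\<lambda>c. c + 1"]) (auto simp: w_def)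
      also have "\<dots> = (\<Sum>y\<in>{1..n}. if x = y then w y else 0) - (\<Sum>y\<in>{1..n}. t * (Q x y * w y))"
        unfolding sum_subtractf[symmetric] by (rule sum.cong) (auto simp: algebra_simps)
      also have "\<dots> = w x - t * (\<Sum>y\<in>{1..n}. Q x y * w y)"
        using x by (simp add: sum_distrib_left)
      finally show ?thesis by simp
    qed
    obtain x where x: "x \<in> {1..n}" "\<And>y. y \<in> {1..n} \<Longrightarrow> \<bar>w y\<bar> \<le> \<bar>w x\<bar>"
    proof -
      have "Max ((\<lambda>x. \<bar>w x\<bar>) ` {1..n}) \<in> (\<lambda>x. \<bar>w x\<bar>) ` {1..n}"
        using \<open>n \<noteq> 0\<close> by (intro Max_in) auto
      then obtain x where "x \<in> {1..n}" "\<bar>w x\<bar> = Max ((\<lambda>x. \<bar>w x\<bar>) ` {1..n})" by auto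
      then show thesis using that[of x] by simp
    qed
    \<comment> \<open>Multiplying by the sign of \<open>w x\<close> treats a positive maximum and a
      negative minimum at once.\<close>
    have "\<bar>w x\<bar> = sgn (w x) * w x" by (metis abs_sgn mult.commute)
    also have "\<dots> = t * (\<Sum>y\<in>{1..n}. Q x y * (sgn (w x) * w y))"
      using arg_cong[OF eq[OF x(1)], of "\<lambda>u. sgn (w x) * u"] by (simp add: sum_distrib_left mult_ac)
    also have "\<dots> \<le> t * (\<Sum>y\<in>{1..n}. Q x y * \<bar>w x\<bar>)"
    proof (rule mult_left_mono[OF sum_mono t])
      fix y assume y: "y \<in> {1..n}"
      show "Q x y * (sgn (w x) * w y) \<le> Q x y * \<bar>w x\<bar>"
      \<comment> \<open>The diagonal entry has no assumed sign, but there both sides are equal; off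
        the diagonal, nonnegativity of \<open>Q\<close> and maximality of \<open>w x\<close>
        apply.\<close>
      proof (cases "x = y")
        case False
        have "sgn (w x) * w y \<le> \<bar>w x\<bar>"
          using x(2)[OF y] by (auto simp: sgn_if)
        then show ?thesis using Q_nonneg[OF x(1) y False] by (rule mult_left_mono)
      qed (metis abs_sgn mult.commute order_refl)
    qed
    also have "\<dots> = 0"
      using Q_sum[OF x(1)] by (simp add: sum_distrib_right[symmetric])
    finally have "w y = 0" if "y \<in> {1..n}" for y
      using x(2)[OF that] by simp
    then have "vec_index v c = 0" if "c < n" for c
      using \<open>\<And>y. y \<in> {1..n} \<Longrightarrow> w y = 0\<close>[of "Suc c"] that by (simp add: w_def)
    then have "v = 0\<^sub>v n" using v(1) by (intro eq_vecI) auto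
    then show False using v(2) by simp
  qed
  from det_non_zero_imp_unit[OF A this, of "()"]
  obtain B where B: "B \<in> carrier_mat n n" "B * ?A = 1\<^sub>m n" "?A * B = 1\<^sub>m n"
    unfolding Units_def ring_mat_simps by blast
  have "inverts_mat ?A B" "inverts_mat B ?A"
    unfolding inverts_mat_def carrier_matD(1)[OF A] carrier_matD(1)[OF B(1)] by (fact B)+
  moreover have "square_mat ?A"
    unfolding square_mat.simps carrier_matD[OF A] ..
  ultimately show ?thesis
    unfolding invertible_mat_def by (intro conjI exI[of _ B])
qed

text \<open>Multiplying the recursion by the inverse gives \<open>R (Suc m) = C * R m\<close>, so
  the powers are identified without computing the inverse.\<close>

lemma mat_neg_power_eqI:
  assumes A: "A \<in> carrier_mat n n" and inv: "invertible_mat A"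
    and R: "\<And>m. R m \<in> carrier_mat n n"
    and R_0: "R 0 = 1\<^sub>m n" and R_Suc: "\<And>m. A * R (Suc m) = R m"
  shows "mat_neg_power A p = R p"
proof -
  obtain B where "A * B = 1\<^sub>m n" "B * A = 1\<^sub>m (dim_row B)"
    using inv A unfolding invertible_mat_def inverts_mat_def by auto
  moreover from this have "B \<in> carrier_mat n n"
    using A by (metis carrier_matD(2) carrier_matI index_mult_mat(3) index_one_mat(3))
  ultimately have "A \<in> Units (ring_mat TYPE(real) n ())"
    using A by (auto simp: Units_def ring_mat_def)
  then obtain C where C: "mat_inverse A = Some C"
    using mat_inverse(1)[OF A, where b = "()"] by (cases "mat_inverse A") auto
  from mat_inverse(2)[OF A C] have CA: "C * A = 1\<^sub>m n" and C': "C \<in> carrier_mat n n" by auto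
  have step: "R (Suc m) = C * R m" for m
    using assoc_mult_mat[OF C' A R, of "Suc m"] R[of "Suc m"] by (simp add: CA R_Suc)
  \<comment> \<open>A matrix power grows by a factor on the right, which is absorbed into
    \<open>R m\<close>; hence \<open>m\<close> must vary in the induction.\<close>
  have "C ^\<^sub>m p * R m = R (p + m)" for p m
  proof (induction p arbitrary: m)
    case 0
    then show ?case using R[of m] C' by auto
  next
    case (Suc p)
    have "C ^\<^sub>m Suc p * R m = C ^\<^sub>m p * (C * R m)"
      using assoc_mult_mat[OF pow_carrier_mat[OF C'] C' R] by simp
    then show ?case using Suc[of "Suc m"] by (simp add: step)
  qed
  from this[of p 0] show ?thesis
    using C' by (simp add: mat_neg_power_def C R_0)
qed

lemma mat_of_entries_cong:
  assumes "\<And>x y. x \<in> {1..n} \<Longrightarrow> y \<in> {1..n} \<Longrightarrow> a x y = b x y"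
  shows "mat_of_entries n a = mat_of_entries n b"
  unfolding mat_of_entries_def using assms by (intro cong_mat) auto

lemma mat_of_entries_mult:
  "mat_of_entries n a * mat_of_entries n b = mat_of_entries n (\<lambda>x z. \<Sum>y\<in>{1..n}. a x y * b y z)"
proof (rule eq_matI)
  fix r c assume "r < dim_row (mat_of_entries n (\<lambda>x z. \<Sum>y\<in>{1..n}. a x y * b y z))"
    "c < dim_col (mat_of_entries n (\<lambda>x z. \<Sum>y\<in>{1..n}. a x y * b y z))"
  then have rc: "r < n" "c < n" by (auto simp: mat_of_entries_def)
  have "(\<Sum>q\<in>{0..<n}. a (r + 1) (q + 1) * b (q + 1) (c + 1)) = (\<Sum>y\<in>{1..n}. a (r + 1) y * b y (c + 1))"
    by (rule sum.reindex_bij_witness[where i = "\<lambda>y. y - 1" and j = "\<lambda>c. c + 1"]) auto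
  then show "(mat_of_entries n a * mat_of_entries n b) $$ (r, c) =
      mat_of_entries n (\<lambda>x z. \<Sum>y\<in>{1..n}. a x y * b y z) $$ (r, c)"
    using rc by (simp add: mat_of_entries_def scalar_prod_def)
qed (auto simp: mat_of_entries_def)


section \<open>The given generator and the representation of its inverse powers\<close>

lemma N_tilde_eq:
  "N_tilde M i b k lam t x y = (if x = y then 1 else 0) - t * Theta M i b k lam x y"
  by (auto simp: N_tilde_def Theta_def)

text \<open>The two bounds on \<open>b j\<close> say precisely that the affine factors are positive.
  In the sum of the two weights the terms with \<open>b j\<close> cancel.\<close>

lemma
  fixes i b :: "nat \<Rightarrow> real"
  assumes i: "i (j - 1) < i j" "i j < i (j + 1)"
    and b: "- 1 / (i (j + 1) - i j) < b j" "b j < 1 / (i j - i (j - 1))"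
  shows q_up_nonneg: "0 \<le> q_up i b j"
    and q_down_nonneg: "0 \<le> q_down i b j"
    and q_up_plus_q_down: "q_up i b j + q_down i b j = 1"
proof -
  have "0 \<le> 1 + (i (j + 1) - i j) * b j" "0 \<le> 1 - (i j - i (j - 1)) * b j"
    using i b by (auto simp: field_simps)
  then show "0 \<le> q_up i b j" "0 \<le> q_down i b j"
    using i by (simp_all add: q_up_def q_down_def)
  have "q_up i b j + q_down i b j = (i (j + 1) - i (j - 1)) / (i (j + 1) - i (j - 1))"
    unfolding q_up_def q_down_def times_divide_eq_left add_divide_distrib[symmetric]
    by (rule arg_cong2[where f = "(/)"]) (auto simp: algebra_simps)
  then show "q_up i b j + q_down i b j = 1" using i by simp
qed

theorem lemma7p1:
  fixes M p :: nat and t :: real and i b k lam :: "nat \<Rightarrow> real"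
  assumes "M \<ge> 3"
    and "t > 0"
    and "strict_mono_on {1..M} i"
    and "\<forall>j\<in>{2..M - 1}. - 1 / (i (j + 1) - i j) < b j \<and> b j < 1 / (i j - i (j - 1))"
    and "\<forall>j\<in>{2..M - 1}. k j \<ge> 0"
    and "\<forall>j\<in>{2..M - 1}. lam j \<ge> 0"
    and "p \<ge> 1"
  shows "invertible_mat (N_tilde_mat M i b k lam t) \<and>
    (\<forall>(\<Omega> :: 'a measure) (Z :: real \<Rightarrow> 'a \<Rightarrow> nat) (T :: 'a \<Rightarrow> real).
      ctmc \<Omega> {1..M + 1} (Theta M i b k lam) Z \<and>
      indep_random_time \<Omega> {1..M + 1} Z T \<and>
      gamma_distributed \<Omega> T p (1 / t) \<longrightarrow>
      (\<forall>j\<in>{1..M + 1}. \<forall>l\<in>{1..M + 1}.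
        \<P>(\<omega> in \<Omega>. Z 0 \<omega> = j) > 0 \<longrightarrow>
        mat_neg_power (N_tilde_mat M i b k lam t) p $$ (j - 1, l - 1) =
          \<P>(\<omega> in \<Omega>. Z (T \<omega>) \<omega> = l \<bar> Z 0 \<omega> = j)))"
proof -
  let ?S = "{1..M + 1}" and ?Q = "Theta M i b k lam" and ?N = "N_tilde_mat M i b k lam t"
  have i_less: "i (j - 1) < i j" "i j < i (j + 1)" if "2 \<le> j" "j \<le> M - 1" for j
    using that by (auto intro!: strict_mono_onD[OF assms(3)])
  have k_tilde_nonneg: "0 \<le> k_tilde M i k j" for j
    using i_less[of j] assms(5) by (auto simp: k_tilde_def)
  have q: "0 \<le> q_up i b j" "0 \<le> q_down i b j" "q_up i b j + q_down i b j = 1"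
    if "2 \<le> j" "j \<le> M - 1" for j
    using q_up_nonneg[of i j b] q_down_nonneg[of i j b] q_up_plus_q_down[of i j b]
      i_less[OF that] assms(4) that by auto
  have N: "?N = mat_of_entries (M + 1) (\<lambda>x y. (if x = y then 1 else 0) - t * ?Q x y)"
    by (simp add: N_tilde_mat_def N_tilde_eq[abs_def])
  have inv: "invertible_mat ?N"
    unfolding N
  proof (rule invertible_mat_minus_generator)
    fix x y assume "x \<in> ?S" "y \<in> ?S" "x \<noteq> y"
    then show "0 \<le> ?Q x y"
      using q[of x] k_tilde_nonneg[of x] assms(6) by (auto simp: Theta_def)
  next
    fix x assume x: "x \<in> ?S"
    show "(\<Sum>y\<in>?S. ?Q x y) = 0"
    proof (cases "2 \<le> x \<and> x \<le> M - 1")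
      case True
      \<comment> \<open>An interior row has at most four nonzero entries, in distinct columns
        because \<open>x\<close> is at most \<open>M - 1\<close>. The rate into state
        \<open>M + 1\<close> cancels against its part of the diagonal, and the neighbour weights sum
        to 1.\<close>
      have "(\<Sum>y\<in>?S. ?Q x y) = (\<Sum>y\<in>{x - 1, x, x + 1, M + 1}. ?Q x y)"
        by (rule sum.mono_neutral_right) (use True in \<open>auto simp: Theta_def\<close>)
      also have "\<dots> = ?Q x (x - 1) + ?Q x x + ?Q x (x + 1) + ?Q x (M + 1)"
      proof -
        have "x - 1 \<noteq> x" "x - 1 \<noteq> x + 1" "x - 1 \<noteq> M + 1" "x \<noteq> M + 1" "x \<noteq> M"
          using True by auto
        then show ?thesis by simp
      qed
      also have "\<dots> = lam x * (q_up i b x + q_down i b x - 1)"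
        using True by (auto simp: Theta_def algebra_simps)
      finally show ?thesis using q[of x] True by simp
    qed (auto simp: Theta_def)
  qed (use assms(2) in simp)
  moreover have "mat_neg_power ?N p $$ (j - 1, l - 1) = \<P>(\<omega> in \<Omega>. Z (T \<omega>) \<omega> = l \<bar> Z 0 \<omega> = j)"
    if ctmc: "ctmc \<Omega> ?S ?Q Z" and indep: "indep_random_time \<Omega> ?S Z T"
      and gamma: "gamma_distributed \<Omega> T p (1 / t)" and jl: "j \<in> ?S" "l \<in> ?S"
      and pos: "\<P>(\<omega> in \<Omega>. Z 0 \<omega> = j) > 0"
    for \<Omega> :: "'a measure" and Z :: "real \<Rightarrow> 'a \<Rightarrow> nat" and T j l
  proof -
    from ctmc obtain P where P: "transition_function ?S P" "has_intensity_matrix ?S P ?Q"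
        "markov_with_transitions \<Omega> ?S P Z"
      and prob: "prob_space \<Omega>"
      and Z: "\<And>t. 0 \<le> t \<Longrightarrow> Z t \<in> measurable \<Omega> (count_space ?S)"
        "\<And>\<omega> t. \<omega> \<in> space \<Omega> \<Longrightarrow> 0 \<le> t \<Longrightarrow> \<forall>\<^sub>F s in at_right t. Z s \<omega> = Z t \<omega>"
      unfolding ctmc_def by blast
    interpret prob_space \<Omega> by fact
    interpret finite_transition_semigroup ?S P ?Q
      by unfold_locales (use P in auto)
    let ?r = "1 / t"
    have r: "0 < ?r" using assms(2) by simp
    let ?c = "\<P>(\<omega> in \<Omega>. Z 0 \<omega> = j)"
    \<comment> \<open>The index \<open>m\<close> is the Gamma shape, hence the shift by one in
      \<open>gamma_mean\<close>; shape 0 is the chain at time 0, that is, the identity.\<close>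
    define R where "R m = mat_of_entries (M + 1)
      (\<lambda>x z. if m = 0 then P 0 x z else gamma_mean (m - 1) ?r x z)" for m
    have "mat_neg_power ?N p = R p"
    proof (rule mat_neg_power_eqI[OF _ inv])
      show "?N \<in> carrier_mat (M + 1) (M + 1)" "R m \<in> carrier_mat (M + 1) (M + 1)" for m
        by (simp_all add: N_tilde_mat_def R_def mat_of_entries_def)
      show "R 0 = 1\<^sub>m (M + 1)"
        by (rule eq_matI) (auto simp: R_def mat_of_entries_def P_zero)
      show "?N * R (Suc m) = R m" for m
        unfolding N R_def mat_of_entries_mult
      proof (rule mat_of_entries_cong)
        fix x z assume xz: "x \<in> ?S" "z \<in> ?S"
        have "(\<Sum>y\<in>?S. ((if x = y then 1 else 0) - t * ?Q x y) * gamma_mean m ?r y z) =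
            (\<Sum>y\<in>?S. if x = y then gamma_mean m ?r y z else 0) - (\<Sum>y\<in>?S. t * (?Q x y * gamma_mean m ?r y z))"
          unfolding sum_subtractf[symmetric] by (rule sum.cong) (auto simp: algebra_simps)
        \<comment> \<open>Since \<open>t * ?r = 1\<close>, pulling out \<open>t\<close> exposes the
          left side of the resolvent identity with rate \<open>?r\<close>.\<close>
        also have "\<dots> = t * (?r * gamma_mean m ?r x z - (\<Sum>y\<in>?S. ?Q x y * gamma_mean m ?r y z))"
          unfolding sum.delta'[OF finite_S] right_diff_distrib sum_distrib_left using xz assms(2) by simp
        also have "\<dots> = (if m = 0 then P 0 x z else gamma_mean (m - 1) ?r x z)"
          using gamma_mean_resolvent[OF r xz, of m] assms(2) by simp
        finally show "(\<Sum>y\<in>?S. ((if x = y then 1 else 0) - t * ?Q x y) *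
            (if Suc m = 0 then P 0 y z else gamma_mean (Suc m - 1) ?r y z)) =
            (if m = 0 then P 0 x z else gamma_mean (m - 1) ?r x z)"
          by (simp only: nat.simps if_False diff_Suc_1)
      qed
    qed
    then have "mat_neg_power ?N p $$ (j - 1, l - 1) = gamma_mean (p - 1) ?r j l"
      using jl assms(7) by (auto simp: R_def mat_of_entries_def)
    also have "\<dots> = expectation (\<lambda>\<omega>. P (T \<omega>) j l)"
    proof -
      \<comment> \<open>The truncated function is Borel, as the change of variables to the law of
        \<open>T\<close> requires. The truncation is invisible on both sides: the density vanishes
        at negative times and \<open>T\<close> is nonnegative.\<close>
      let ?g = "\<lambda>s. indicat_real {0..} s * P s j l"
      have "gamma_mean (p - 1) ?r j l = (\<integral>s. erlang_density (p - 1) ?r s * ?g s \<partial>lborel)"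
        unfolding gamma_mean_def
        by (rule Bochner_Integration.integral_cong) (auto simp: erlang_density_def indicator_def)
      also have "\<dots> = expectation (\<lambda>\<omega>. ?g (T \<omega>))"
        by (rule distributed_integral)
          (use gamma P_measurable[OF jl] r in \<open>auto simp: gamma_distributed_def\<close>)
      also have "\<dots> = expectation (\<lambda>\<omega>. P (T \<omega>) j l)"
        by (rule Bochner_Integration.integral_cong)
          (use indep in \<open>auto simp: indep_random_time_def indicator_def\<close>)
      finally show ?thesis .
    qed
    also have "\<dots> = \<P>(\<omega> in \<Omega>. Z (T \<omega>) \<omega> = l \<bar> Z 0 \<omega> = j)"
    proof -
      have "\<P>(\<omega> in \<Omega>. Z (T \<omega>) \<omega> = l \<and> Z 0 \<omega> = j) = ?c * expectation (\<lambda>\<omega>. P (T \<omega>) j l)"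
      proof (rule prob_at_independent_time[OF Z _ indep])
        show "T \<in> borel_measurable \<Omega>"
          using gamma by (auto simp: gamma_distributed_def distributed_def)
        show "\<P>(\<omega> in \<Omega>. Z s \<omega> = l \<and> Z 0 \<omega> = j) = ?c * P s j l" if "0 \<le> s" for s
        proof -
          \<comment> \<open>The Markov property with a single conditioning time, namely 0.\<close>
          have "\<P>(\<omega> in \<Omega>. Z s \<omega> = l \<bar> Z 0 \<omega> = j) = P s j l"
            using P(3)[unfolded markov_with_transitions_def, rule_format, of "\<lambda>_. 0" 0 s "\<lambda>_. j" l]
              that jl pos by simp
          then show ?thesis using pos by (simp add: cond_prob_def field_simps)
        qed
      qed (use P_continuous_on P_abs_le_one jl in auto)
      then show ?thesis using pos by (simp add: cond_prob_def)
    qed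
    finally show ?thesis .
  qed
  ultimately show ?thesis by blast
qed

end
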